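(* Let $F$ be an infinite field with $\operatorname{char}(F)\ne 2$, let $n\ge 2$, let $f=f(X_1,\dots,X_m)\in F\langle \mathcal X\rangle$ be a polynomial which is neither an identity nor a central polynomial of $M_n(F)$, let $k\ge 1$, and let $B$ be a unital (associative) $F$-algebra such that every element in $A=M_n(B)$ is a sum of $k$ commutators and a central element. Then every commutator in $A$ is a sum of $1936k^2+22k$ elements from $f(A)-f(A)$.
   Context: $F\langle \mathcal X\rangle$ is the free (unital, associative) algebra over $F$ on $\mathcal X=\{X_1,X_2,\dots\}$, i.e. the algebra of noncommutative polynomials. For a unital $F$-algebra $R$, $f(R)=\{f(a_1,\dots,a_m)\mid a_1,\dots,a_m\in R\}$ and $f(R)-f(R)=\{t-t'\mid t,t'\in f(R)\}$. $f$ is an identity of $R$ if $f(R)=\{0\}$; $f$ is a central polynomial of $R$ if $f(R)$ is contained in the center of $R$ but $f$ is not an identity of $R$ (a nonzero constant term is allowed). A commutator in $A$ is an element of the form $[x,y]=xy-yx$ with $x,y\in A$; a central element is an element of the center of $A$. *)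

theory Defs
  imports
    "HOL-Analysis.Analysis"
    "HOL-Library.Poly_Mapping"
begin

(* The free monoid on countably many letters, in additive notation as \<open>Poly_Mapping\<close> expects for its
   convolution product; \<open>0\<close> is the empty word and \<open>+\<close> is concatenation.  A fresh type is
   needed because lists do not belong to \<open>monoid_add\<close>. *)
datatype word = Word (letters: "nat list")

instantiation word :: monoid_add
begin

definition zero_word :: word where "0 = Word []"

definition plus_word :: "word \<Rightarrow> word \<Rightarrow> word" where
  "u + v = Word (letters u @ letters v)"

instance
  by standard (simp_all add: zero_word_def plus_word_def)

end

(* The monoid algebra of the free monoid, i.e. the free unital associative algebra. *)
type_synonym 'f free_algebra = "word \<Rightarrow>\<^sub>0 'f"

definition nc_vars :: "'f::zero free_algebra \<Rightarrow> nat set" where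
  "nc_vars f = (\<Union>w\<in>Poly_Mapping.keys f. set (letters w))"

locale unital_algebra = vector_space smul
  for smul :: "'f::field \<Rightarrow> 'b::ring_1 \<Rightarrow> 'b" +
  assumes smul_mult_left: "smul c (x * y) = smul c x * y"
    and smul_mult_right: "smul c (x * y) = x * smul c y"

lemma unital_algebra_field: "unital_algebra ((*) :: 'f::field \<Rightarrow> 'f \<Rightarrow> 'f)"
  by unfold_locales (simp_all add: algebra_simps)

(* On the type \<open>'b ^ 'n ^ 'n\<close> the overloaded product and unit are entrywise, so the ring
   structure of \<open>M\<^sub>n(B)\<close> is given by \<open>matrix_matrix_mult\<close> and \<open>mat 1\<close>. *)

definition mat_scale :: "('f \<Rightarrow> 'b \<Rightarrow> 'b) \<Rightarrow> 'f \<Rightarrow> 'b ^ 'n ^ 'n \<Rightarrow> 'b ^ 'n ^ 'n" where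
  "mat_scale smul c A = (\<chi> i j. smul c (A $ i $ j))"

definition mat_prod_list :: "('b::semiring_1 ^ 'n ^ 'n) list \<Rightarrow> 'b ^ 'n ^ 'n" where
  "mat_prod_list As = foldr (**) As (mat 1)"

definition nc_eval ::
  "('f::zero \<Rightarrow> 'b::ring_1 \<Rightarrow> 'b) \<Rightarrow> 'f free_algebra \<Rightarrow> (nat \<Rightarrow> 'b ^ 'n ^ 'n) \<Rightarrow> 'b ^ 'n ^ 'n" where
  "nc_eval smul f a =
     (\<Sum>w\<in>Poly_Mapping.keys f.
        mat_scale smul (Poly_Mapping.lookup f w) (mat_prod_list (map a (letters w))))"

(* \<open>f(M\<^sub>n(B))\<close>.  Arguments are supplied for all variables at once; only those in \<open>nc_vars f\<close>
   influence the value. *)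
definition nc_image ::
  "('f::zero \<Rightarrow> 'b::ring_1 \<Rightarrow> 'b) \<Rightarrow> 'f free_algebra \<Rightarrow> ('b ^ 'n ^ 'n) set" where
  "nc_image smul f = {nc_eval smul f a | a. True}"

definition mat_center :: "('b::semiring_1 ^ 'n ^ 'n) set" where
  "mat_center = {z. \<forall>x. z ** x = x ** z}"

definition mat_commutators :: "('b::ring_1 ^ 'n ^ 'n) set" where
  "mat_commutators = {x ** y - y ** x | x y. True}"

(* In the next two definitions the matrix size, not determined by the other arguments, is
   passed as a type. *)

definition nc_identity ::
  "'n::finite itself \<Rightarrow> ('f::zero \<Rightarrow> 'b::ring_1 \<Rightarrow> 'b) \<Rightarrow> 'f free_algebra \<Rightarrow> bool" where
  "nc_identity _ smul f \<longleftrightarrow> nc_image smul f = {0 :: 'b ^ 'n ^ 'n}"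

definition nc_central_polynomial ::
  "'n::finite itself \<Rightarrow> ('f::zero \<Rightarrow> 'b::ring_1 \<Rightarrow> 'b) \<Rightarrow> 'f free_algebra \<Rightarrow> bool" where
  "nc_central_polynomial N smul f \<longleftrightarrow>
     nc_image smul f \<subseteq> (mat_center :: ('b ^ 'n ^ 'n) set) \<and> \<not> nc_identity N smul f"

definition differences :: "'a::minus set \<Rightarrow> 'a set" where
  "differences S = {t - t' | t t'. t \<in> S \<and> t' \<in> S}"

definition sums_of :: "nat \<Rightarrow> 'a::comm_monoid_add set \<Rightarrow> 'a set" where
  "sums_of k S = {\<Sum>i<k. s i | s. \<forall>i<k. s i \<in> S}"

end

theory Submission
  imports Defs
begin

text \<open>
  Let \<open>D = f(A) - f(A)\<close>. As \<open>f(A)\<close> is invariant under conjugation and 2 is invertible, conjugating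
  \<open>a \<in> f(A)\<close> by \<open>1 \<plusminus> x/2\<close> with \<open>x\<^sup>2 = 0\<close> gives \<open>[x, a] \<in> D\<close>. Suppose that \<open>a\<close> has scalar entries and an
  invertible minor with disjoint row and column sets of size at least \<open>n/3\<close>, with inverse \<open>t\<close>. For \<open>x\<close>
  in the block opposite to this minor, conjugating \<open>[a, x/2] \<in> D\<close> by \<open>1 + t\<close> changes it by \<open>x\<close>, so \<open>x\<close> is a
  sum of two elements of \<open>D\<close>; permutation matrices carry this over to every off-diagonal block of that
  size. A partition of the indices into three such sets writes any commutator as a sum of boundedly
  many conjugates of elements of off-diagonal blocks, with a bound (108) that depends on neither \<open>n\<close> nor \<open>k\<close>.

  A value \<open>a\<close> with such a minor exists because the skew polynomial ring \<open>K[x; \<sigma>]\<close>, with \<open>K\<close> the ring of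
  polynomial functions in \<open>n\<close> variables and \<open>\<sigma>\<close> their cyclic shift, specialises onto \<open>M\<^sub>n(F)\<close>. A noncentral
  value of \<open>f\<close> lifts to a noncentral element of \<open>K[x; \<sigma>]\<close>. The coefficients of this element, being nonzero
  polynomials together with all their shifts, yield large minors at generic points.
\<close>

section \<open>Sums of bounded length\<close>

lemma sums_ofE:
  assumes "x \<in> sums_of k S"
  obtains s where "x = (\<Sum>i<k. s i)" "\<And>i. i < k \<Longrightarrow> s i \<in> S"
  using assms unfolding sums_of_def by blast

lemma sums_of_zero: "0 \<in> sums_of 0 S"
  by (auto simp: sums_of_def)

lemma sums_of_add:
  fixes x y :: "'a::comm_monoid_add"
  assumes "x \<in> sums_of j S" "y \<in> sums_of l S"
  shows "x + y \<in> sums_of (j + l) S"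
proof -
  obtain s t where s: "x = (\<Sum>i<j. s i)" "\<forall>i<j. s i \<in> S"
    and t: "y = (\<Sum>i<l. t i)" "\<forall>i<l. t i \<in> S"
    using assms by (auto simp: sums_of_def)
  define r where "r i = (if i < j then s i else t (i - j))" for i
  have "(\<Sum>i<j + l. r i) = (\<Sum>i<j. r i) + (\<Sum>i<l. r (i + j))"
    by (induction l) (simp_all add: algebra_simps)
  also have "\<dots> = x + y"
    by (simp add: r_def s t)
  finally have "x + y = (\<Sum>i<j + l. r i)" ..
  moreover have "\<forall>i<j + l. r i \<in> S"
    using s t by (auto simp: r_def)
  ultimately show ?thesis
    by (auto simp: sums_of_def)
qed

lemma sums_of_one: "x \<in> S \<Longrightarrow> x \<in> sums_of 1 S"
  unfolding sums_of_def by (auto intro!: exI[of _ "\<lambda>_. x"])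

lemma sums_of_mono:
  assumes "0 \<in> S" "x \<in> sums_of j S" "j \<le> l"
  shows "x \<in> sums_of l S"
proof -
  have "0 \<in> sums_of (l - j) S"
    using assms(1) by (auto simp: sums_of_def intro!: exI[of _ "\<lambda>_. 0"])
  then show ?thesis
    using sums_of_add[OF assms(2)] assms(3) by fastforce
qed

lemma sums_of_sum:
  assumes "finite A" "\<And>a. a \<in> A \<Longrightarrow> g a \<in> sums_of c S"
  shows "sum g A \<in> sums_of (card A * c) S"
  using assms by (induction A rule: finite_induct) (auto intro: sums_of_zero sums_of_add)

section \<open>Matrices over a ring\<close>

lemma matrix_mult_add_left:
  fixes A B :: "'b::ring_1 ^ 'n ^ 'm"
  shows "(A + B) ** C = A ** C + B ** C"
  by (simp add: matrix_matrix_mult_def vec_eq_iff distrib_right sum.distrib)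

lemma matrix_mult_diff_left:
  fixes A B :: "'b::ring_1 ^ 'n ^ 'm"
  shows "(A - B) ** C = A ** C - B ** C"
  by (simp add: matrix_matrix_mult_def vec_eq_iff left_diff_distrib sum_subtractf)

lemma matrix_mult_diff_right:
  fixes A :: "'b::ring_1 ^ 'n ^ 'm"
  shows "A ** (B - C) = A ** B - A ** C"
  by (simp add: matrix_matrix_mult_def vec_eq_iff right_diff_distrib sum_subtractf)

lemma matrix_mult_minus_left:
  fixes A :: "'b::ring_1 ^ 'n ^ 'm"
  shows "(- A) ** C = - (A ** C)"
  by (simp add: matrix_matrix_mult_def vec_eq_iff sum_negf)

lemma matrix_mult_minus_right:
  fixes A :: "'b::ring_1 ^ 'n ^ 'm"
  shows "A ** (- C) = - (A ** C)"
  by (simp add: matrix_matrix_mult_def vec_eq_iff sum_negf)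

lemma matrix_mult_zero [simp]:
  fixes A :: "'b::ring_1 ^ 'n ^ 'm"
  shows "A ** 0 = 0" "0 ** B = (0 :: 'b ^ 'n ^ 'm)"
  by (simp_all add: matrix_matrix_mult_def vec_eq_iff)

lemma matrix_mult_sum_left:
  fixes g :: "'i \<Rightarrow> 'b::ring_1 ^ 'n ^ 'm"
  shows "(\<Sum>i\<in>I. g i) ** C = (\<Sum>i\<in>I. g i ** C)"
  by (induction I rule: infinite_finite_induct) (simp_all add: matrix_mult_add_left)

lemma matrix_mult_sum_right:
  fixes g :: "'i \<Rightarrow> 'b::ring_1 ^ 'n ^ 'm"
  shows "C ** (\<Sum>i\<in>I. g i) = (\<Sum>i\<in>I. C ** g i)"
  by (induction I rule: infinite_finite_induct) (simp_all add: matrix_add_ldistrib)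

lemmas matrix_distribs =
  matrix_add_ldistrib matrix_mult_add_left matrix_mult_diff_left matrix_mult_diff_right
  matrix_mult_minus_left matrix_mult_minus_right

section \<open>Diagonal idempotents, permutation matrices and blocks\<close>

definition diag_proj :: "'n set \<Rightarrow> 'b::ring_1 ^ 'n ^ 'n" where
  "diag_proj S = (\<chi> i j. if i = j \<and> i \<in> S then 1 else 0)"

definition perm_mat :: "('n \<Rightarrow> 'n) \<Rightarrow> 'b::ring_1 ^ 'n ^ 'n" where
  "perm_mat p = (\<chi> i j. if i = p j then 1 else 0)"

definition block :: "'n set \<Rightarrow> 'n set \<Rightarrow> ('b::ring_1 ^ 'n ^ 'n) set" where
  "block S T = {x. \<forall>i j. x $ i $ j \<noteq> 0 \<longrightarrow> i \<in> S \<and> j \<in> T}"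

lemma diag_proj_mult [simp]: "(diag_proj S ** x) $ i $ j = (if i \<in> S then x $ i $ j else 0)"
proof -
  have "(diag_proj S ** x) $ i $ j = (\<Sum>k\<in>UNIV. if i = k then (if i \<in> S then x $ k $ j else 0) else 0)"
    unfolding matrix_matrix_mult_def diag_proj_def vec_lambda_beta by (intro sum.cong) auto
  then show ?thesis by simp
qed

lemma mult_diag_proj [simp]: "(x ** diag_proj S) $ i $ j = (if j \<in> S then x $ i $ j else 0)"
proof -
  have "(x ** diag_proj S) $ i $ j = (\<Sum>k\<in>UNIV. if k = j then (if j \<in> S then x $ i $ k else 0) else 0)"
    unfolding matrix_matrix_mult_def diag_proj_def vec_lambda_beta by (intro sum.cong) auto
  then show ?thesis by simp
qed

lemma block_iff: "x \<in> block S T \<longleftrightarrow> diag_proj S ** x ** diag_proj T = x"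
  by (auto simp: block_def vec_eq_iff)

lemma block_left: "x \<in> block S T \<Longrightarrow> diag_proj S ** x = x"
  and block_right: "x \<in> block S T \<Longrightarrow> x ** diag_proj T = x"
  by (auto simp: block_def vec_eq_iff)

lemma block_mult:
  assumes "x \<in> block S T" "y \<in> block U V"
  shows "x ** y \<in> block S V"
proof -
  have "diag_proj S ** (x ** y) ** diag_proj V = (diag_proj S ** x) ** (y ** diag_proj V)"
    by (simp add: matrix_mul_assoc)
  then show ?thesis
    by (simp add: block_iff block_left[OF assms(1)] block_right[OF assms(2)])
qed

lemma block_mult_disjoint:
  assumes "x \<in> block S T" "y \<in> block U V" "T \<inter> U = {}"
  shows "x ** y = 0"
proof -
  have "x $ i $ k * y $ k $ j = 0" for i k j
    using assms unfolding block_def disjoint_iff by (metis (mono_tags, lifting) mem_Collect_eq mult_zero_left mult_zero_right)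
  then show ?thesis
    by (simp add: matrix_matrix_mult_def vec_eq_iff)
qed

lemma block_minus: "x \<in> block S T \<Longrightarrow> - x \<in> block S T"
  by (auto simp: block_def)

lemma block_diag_proj: "diag_proj S \<in> block S S"
  by (auto simp: block_def diag_proj_def split: if_splits)

lemma block_compress: "diag_proj S ** x ** diag_proj T \<in> block S T"
  by (auto simp: block_def split: if_splits)

lemma perm_mat_mult:
  assumes "bij p"
  shows "(perm_mat p ** x) $ i $ j = x $ (inv p i) $ j"
proof -
  have "(perm_mat p ** x) $ i $ j = (\<Sum>k\<in>UNIV. if k = inv p i then x $ k $ j else 0)"
    unfolding matrix_matrix_mult_def perm_mat_def vec_lambda_beta using assms
    by (intro sum.cong) (auto simp: bij_inv_eq_iff bij_def)
  then show ?thesis by simp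
qed

lemma mult_perm_mat:
  shows "(x ** perm_mat p) $ i $ j = x $ i $ (p j)"
proof -
  have "(x ** perm_mat p) $ i $ j = (\<Sum>k\<in>UNIV. if k = p j then x $ i $ k else 0)"
    unfolding matrix_matrix_mult_def perm_mat_def vec_lambda_beta
    by (intro sum.cong) auto
  then show ?thesis by simp
qed

lemma perm_mat_inverse:
  fixes p :: "'n::finite \<Rightarrow> 'n"
  assumes "bij p"
  shows "perm_mat p ** perm_mat (inv p) = (mat 1 :: 'b::ring_1 ^ 'n ^ 'n)"
    and "perm_mat (inv p) ** perm_mat p = (mat 1 :: 'b::ring_1 ^ 'n ^ 'n)"
  using assms
  by (auto simp: vec_eq_iff mult_perm_mat mat_def bij_is_surj surj_f_inv_f inv_f_f bij_is_inj)
    (auto simp: perm_mat_def bij_is_surj surj_f_inv_f inv_f_f bij_is_inj)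

lemma perm_mat_block:
  assumes "bij p" "x \<in> block S T"
  shows "perm_mat p ** x \<in> block (p ` S) T"
  using assms by (auto simp: block_def perm_mat_mult bij_inv_eq_iff image_iff) 
    (metis bij_inv_eq_iff)

lemma block_perm_mat:
  assumes "bij p" "x \<in> block S T"
  shows "x ** perm_mat (inv p) \<in> block S (p ` T)"
  using assms by (auto simp: block_def mult_perm_mat image_iff)
    (metis bij_inv_eq_iff)

lemma block_mono: "x \<in> block S T \<Longrightarrow> S \<subseteq> S' \<Longrightarrow> T \<subseteq> T' \<Longrightarrow> x \<in> block S' T'"
  by (auto simp: block_def)

lemma square_zero_inverse:
  fixes h :: "'b::ring_1 ^ 'n ^ 'n"
  assumes "h ** h = 0"
  shows "(mat 1 + h) ** (mat 1 - h) = mat 1" "(mat 1 - h) ** (mat 1 + h) = mat 1"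
  using assms by (simp_all add: matrix_distribs)

section \<open>Conjugation-invariant sets of matrices\<close>

text \<open>The inverse is given by both one-sided conditions, since over a noncommutative ring
  neither implies the other in general.\<close>

definition conj_closed :: "('b::ring_1 ^ 'n ^ 'n) set \<Rightarrow> bool" where
  "conj_closed I \<longleftrightarrow>
     (\<forall>x\<in>I. \<forall>g g'. g ** g' = mat 1 \<longrightarrow> g' ** g = mat 1 \<longrightarrow> g ** x ** g' \<in> I)"

lemma conj_closedD:
  "conj_closed I \<Longrightarrow> x \<in> I \<Longrightarrow> g ** g' = mat 1 \<Longrightarrow> g' ** g = mat 1 \<Longrightarrow> g ** x ** g' \<in> I"
  by (auto simp: conj_closed_def)

lemma conj_closed_differences: "conj_closed I \<Longrightarrow> conj_closed (differences I)"
  unfolding conj_closed_def differences_def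
  by (clarsimp simp: matrix_distribs) blast

lemma conj_closed_sums_of:
  fixes I :: "('b::ring_1 ^ 'n ^ 'n) set"
  assumes "conj_closed I"
  shows "conj_closed (sums_of k I)"
proof -
  have "g ** x ** g' \<in> sums_of k I"
    if x: "x \<in> sums_of k I" and "g ** g' = mat 1" "g' ** g = mat 1" for x g g' :: "'b ^ 'n ^ 'n"
  proof -
    obtain s where "x = (\<Sum>i<k. s i)" "\<And>i. i < k \<Longrightarrow> s i \<in> I"
      using sums_ofE[OF x] by blast
    then show ?thesis
      using assms that(2,3) unfolding sums_of_def
      by (auto simp: matrix_mult_sum_left matrix_mult_sum_right conj_closed_def
          intro!: exI[of _ "\<lambda>i. g ** s i ** g'"])
  qed
  then show ?thesis by (auto simp: conj_closed_def)
qed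

lemma differences_minus: "x \<in> differences S \<Longrightarrow> - x \<in> differences S" for x :: "'a::group_add"
  unfolding differences_def by (auto; metis minus_diff_eq)

text \<open>Conjugation by \<open>1 + h\<close> and by \<open>1 - h\<close> gives the same terms of
  degree 0 and 2 in \<open>h\<close>; the difference is twice the linear term
  \<open>[h, a]\<close>.\<close>

lemma commutator_square_zero:
  assumes "conj_closed I" "a \<in> I" "h ** h = 0"
  shows "(h + h) ** a - a ** (h + h) \<in> differences I"
proof -
  have "(mat 1 + h) ** a ** (mat 1 - h) \<in> I" "(mat 1 - h) ** a ** (mat 1 + h) \<in> I"
    using assms conj_closedD square_zero_inverse by blast+
  moreover have "(h + h) ** a - a ** (h + h)
      = (mat 1 + h) ** a ** (mat 1 - h) - (mat 1 - h) ** a ** (mat 1 + h)"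
    by (simp add: matrix_distribs)
  ultimately show ?thesis
    unfolding differences_def by blast
qed

text \<open>With \<open>M = [a, x/2]\<close>, conjugating \<open>M\<close> by \<open>1 + t\<close> changes it by exactly \<open>x\<close>.\<close>

lemma block_sum_of_two_differences:
  fixes a :: "'b::ring_1 ^ 'n ^ 'n" and u :: 'b
  assumes I: "conj_closed I" "a \<in> I" and u: "u + u = 1" and disj: "S \<inter> T = {}"
    and t: "t \<in> block S T" "t ** a ** diag_proj S = diag_proj S" "diag_proj T ** a ** t = diag_proj T"
    and x: "x \<in> block S T"
  shows "x \<in> sums_of 2 (differences I)"
proof -
  \<comment> \<open>With \<open>u\<close> as one half, \<open>h\<close> is a quarter of
    \<open>x\<close> and \<open>y\<close> is half of \<open>x\<close>; the commutator obtained from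
    \<open>h\<close> is \<open>[h + h, a] = [y, a]\<close>.\<close>
  define h where "h = (\<chi> i j. u * (u * x $ i $ j))"
  define y where "y = h + h"
  have uu: "u * z + u * z = z" for z
    by (metis u distrib_right mult_1)
  have h: "h \<in> block S T"
    using x unfolding block_def h_def by (simp del: mult_eq_0_iff) (metis mult_zero_right)
  have y: "y \<in> block S T"
    using h unfolding block_def y_def by (simp, metis add_0)
  have yy: "y + y = x"
  proof -
    have "y = (\<chi> i j. u * x $ i $ j)"
      unfolding y_def h_def by (simp add: vec_eq_iff uu)
    then show ?thesis by (simp add: vec_eq_iff uu)
  qed
  have disj': "T \<inter> S = {}" using disj by blast
  have "h ** h = 0"
    using h disj' by (intro block_mult_disjoint)
  then have M: "y ** a - a ** y \<in> differences I" (is "?M \<in> _")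
    using commutator_square_zero I unfolding y_def by blast
  \<comment> \<open>The linear terms \<open>t ** a ** y\<close> and \<open>y ** a ** t\<close> both
    equal \<open>y\<close>, as \<open>t\<close> inverts the minor; every other new term contains
    \<open>t ** y\<close> or \<open>y ** t\<close>, which vanish by disjointness.\<close>
  have tay: "t ** a ** y = y"
    by (metis block_left[OF y] matrix_mul_assoc t(2))
  have yat: "y ** a ** t = y"
    by (metis block_right[OF y] matrix_mul_assoc t(3))
  have ty: "t ** y = 0" "y ** t = 0" "t ** t = 0"
    using t(1) y disj' block_mult_disjoint by blast+
  have "(mat 1 + t) ** (- ?M) ** (mat 1 - t) \<in> differences I"
    by (intro conj_closedD conj_closed_differences differences_minus I M square_zero_inverse ty)
  moreover have "(mat 1 + t) ** (- ?M) ** (mat 1 - t) + ?M = x"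
  proof -
    have "(mat 1 + t) ** (- ?M) ** (mat 1 - t)
      = - ?M + (t ** a ** y - t ** y ** a) - (a ** (y ** t) - y ** a ** t)
        - (t ** a ** (y ** t) - t ** y ** a ** t)"
      by (simp add: matrix_distribs matrix_mul_assoc algebra_simps)
    also have "\<dots> = - ?M + y + y"
      by (simp add: tay yat ty)
    finally show ?thesis using yy by (simp add: add.assoc)
  qed
  ultimately show ?thesis
    using sums_of_add[OF sums_of_one sums_of_one, OF _ M] by (metis one_add_one)
qed

section \<open>Permutations of the indices and transport of blocks\<close>

lemma inj_on_extends_to_bij:
  fixes f :: "'n::finite \<Rightarrow> 'n"
  assumes "inj_on f A"
  shows "\<exists>p. bij p \<and> (\<forall>x\<in>A. p x = f x)"
proof -
  have "card (- A) = card (- f ` A)"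
    by (simp add: Compl_eq_Diff_UNIV card_Diff_subset card_image[OF assms])
  then obtain q where q: "bij_betw q (- A) (- f ` A)"
    using finite_same_card_bij[of "- A" "- f ` A"] by auto
  define p where "p x = (if x \<in> A then f x else q x)" for x
  have "bij_betw p A (f ` A)" "bij_betw p (- A) (- f ` A)"
    using q assms by (auto simp: p_def bij_betw_def inj_on_def)
  then have "bij_betw p (A \<union> - A) (f ` A \<union> - f ` A)"
    by (rule bij_betw_combine) auto
  then have "bij p" by (simp add: Compl_partition)
  then show ?thesis by (auto simp: p_def)
qed

text \<open>Injections of \<open>S'\<close> into \<open>S\<close> and of \<open>T'\<close> into
  \<open>T\<close> glue to an injection because their targets are disjoint, and this extends to a
  permutation of the finite index set.\<close>

lemma bij_into_disjoint:
  fixes S T S' T' :: "'n::finite set"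
  assumes "S \<inter> T = {}" "S' \<inter> T' = {}" "card S' \<le> card S" "card T' \<le> card T"
  shows "\<exists>p. bij p \<and> p ` S' \<subseteq> S \<and> p ` T' \<subseteq> T"
proof -
  obtain f g where f: "f ` S' \<subseteq> S" "inj_on f S'" and g: "g ` T' \<subseteq> T" "inj_on g T'"
    using assms card_le_inj[of S' S] card_le_inj[of T' T] by auto
  define h where "h x = (if x \<in> S' then f x else g x)" for x
  have hT: "h x = g x" if "x \<in> T'" for x
    using that assms(2) by (auto simp: h_def)
  have "inj_on h (S' \<union> T')"
  proof (rule inj_onI)
    fix x y assume xy: "x \<in> S' \<union> T'" "y \<in> S' \<union> T'" "h x = h y"
    have "h z \<in> S \<longleftrightarrow> z \<in> S'" if "z \<in> S' \<union> T'" for z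
      using that f(1) g(1) assms(1) by (auto simp: h_def)
    then have "x \<in> S' \<longleftrightarrow> y \<in> S'"
      using xy by metis
    with xy show "x = y"
      using f(2) g(2) by (cases "x \<in> S'") (auto simp: h_def dest: inj_onD)
  qed
  then obtain p where "bij p" "\<forall>x\<in>S' \<union> T'. p x = h x"
    using inj_on_extends_to_bij by blast
  then have "p ` S' \<subseteq> S" "p ` T' \<subseteq> T"
    using f(1) g(1) hT by (auto simp: h_def)
  with \<open>bij p\<close> show ?thesis by blast
qed

text \<open>Conjugation by a permutation matrix relabels rows and columns and so moves
  \<open>block S' T'\<close> into \<open>block S T\<close>; conjugating back stays in
  \<open>V\<close>.\<close>

lemma block_transport:
  fixes S T S' T' :: "'n::finite set" and V :: "('b::ring_1 ^ 'n ^ 'n) set"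
  assumes V: "conj_closed V" "block S T \<subseteq> V"
    and "S \<inter> T = {}" "S' \<inter> T' = {}" "card S' \<le> card S" "card T' \<le> card T"
  shows "block S' T' \<subseteq> V"
proof
  fix x :: "'b ^ 'n ^ 'n" assume x: "x \<in> block S' T'"
  obtain p where p: "bij p" "p ` S' \<subseteq> S" "p ` T' \<subseteq> T"
    using bij_into_disjoint assms by metis
  let ?P = "perm_mat p :: 'b ^ 'n ^ 'n" and ?Q = "perm_mat (inv p) :: 'b ^ 'n ^ 'n"
  note PQ = perm_mat_inverse[OF p(1), where 'b = 'b]
  have "?P ** x ** ?Q \<in> block (p ` S') (p ` T')"
    using p x by (intro block_perm_mat perm_mat_block)
  then have "?P ** x ** ?Q \<in> V"
    using V(2) p block_mono by blast
  then have "?Q ** (?P ** x ** ?Q) ** ?P \<in> V"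
    using V(1) PQ conj_closedD by blast
  also have "?Q ** (?P ** x ** ?Q) ** ?P = (?Q ** ?P) ** x ** (?Q ** ?P)"
    by (simp add: matrix_mul_assoc)
  finally show "x \<in> V" by (simp add: PQ)
qed

section \<open>Commutators as sums of conjugates of off-diagonal blocks\<close>

text \<open>Since \<open>u ** u = 0\<close>, conjugating \<open>v\<close> by \<open>1 + u\<close>
  gives \<open>v + [u, v] - u v u\<close>, where \<open>v\<close> and \<open>u v u\<close> lie in
  the two given blocks.\<close>

lemma commutator_opposite_blocks:
  fixes V :: "('b::ring_1 ^ 'n::finite ^ 'n) set"
  assumes V: "conj_closed V"
    and "block P Q \<subseteq> V" "block Q P \<subseteq> V" "P \<inter> Q = {}"
    and u: "u \<in> block P Q" and v: "v \<in> block Q P"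
  shows "u ** v - v ** u \<in> sums_of 3 V"
proof -
  have uu: "u ** u = 0"
    using block_mult_disjoint[OF u u] assms by blast
  have "(mat 1 + u) ** v ** (mat 1 - u) \<in> V"
    using V v assms by (intro conj_closedD square_zero_inverse uu) auto
  moreover have "- v \<in> V" "u ** v ** u \<in> V"
    using assms block_minus[OF v] block_mult[OF block_mult[OF u v] u] by auto
  ultimately have "(mat 1 + u) ** v ** (mat 1 - u) + (- v) + u ** v ** u \<in> sums_of (1 + 1 + 1) V"
    by (intro sums_of_add sums_of_one)
  moreover have "(mat 1 + u) ** v ** (mat 1 - u) + (- v) + u ** v ** u = u ** v - v ** u"
    by (simp add: matrix_distribs)
  ultimately show ?thesis by (simp add: numeral_3_eq_3)
qed

text \<open>For \<open>p, q\<close> in the corner of \<open>P\<close> and a permutation matrix \<open>W\<close> moving \<open>P\<close> off itself,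
  \<open>[p, q] = [p W\<^sup>-\<^sup>1, W q] + [- q p W\<^sup>-\<^sup>1, W e]\<close> with \<open>e\<close> the unit of the corner.\<close>

lemma commutator_corner:
  fixes V :: "('b::ring_1 ^ 'n::finite ^ 'n) set"
  assumes V: "conj_closed V"
    and blocks: "\<And>Q R. Q \<inter> R = {} \<Longrightarrow> card Q \<le> m \<Longrightarrow> card R \<le> m \<Longrightarrow> block Q R \<subseteq> V"
    and P: "card P \<le> m" "2 * card P \<le> CARD('n)"
    and x: "x \<in> block P P" and y: "y \<in> block P P"
  shows "x ** y - y ** x \<in> sums_of 6 V"
proof -
  \<comment> \<open>At most half of the indices lie in \<open>P\<close>, so \<open>P\<close> injects
    into its complement.\<close>
  have "card P \<le> card (- P)"
    using P(2) by (simp add: Compl_eq_Diff_UNIV card_Diff_subset)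
  then obtain f where f: "f ` P \<subseteq> - P" "inj_on f P"
    using card_le_inj[of P "- P"] by auto
  then obtain p where p: "bij p" "\<forall>x\<in>P. p x = f x"
    using inj_on_extends_to_bij by blast
  define P' where "P' = p ` P"
  have P': "P \<inter> P' = {}" "card P' \<le> m"
    using f p P(1) card_image_le[of P p] by (auto simp: P'_def)
  have blk: "block P P' \<subseteq> V" "block P' P \<subseteq> V"
    using P' P(1) blocks by (blast+)
  let ?W = "perm_mat p :: 'b ^ 'n ^ 'n" and ?W' = "perm_mat (inv p) :: 'b ^ 'n ^ 'n"
  have W: "?W' ** ?W = mat 1"
    using perm_mat_inverse p by blast
  let ?e = "diag_proj P :: 'b ^ 'n ^ 'n"
  have in1: "z ** ?W' \<in> block P P'" "?W ** z \<in> block P' P" if "z \<in> block P P" for z :: "'b ^ 'n ^ 'n"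
    using that p(1) block_perm_mat perm_mat_block by (auto simp: P'_def)
  have yx: "- (y ** x) \<in> block P P"
    using x y block_mult block_minus by blast
  have "(x ** ?W') ** (?W ** y) - (?W ** y) ** (x ** ?W') \<in> sums_of 3 V"
       "(- (y ** x) ** ?W') ** (?W ** ?e) - (?W ** ?e) ** (- (y ** x) ** ?W') \<in> sums_of 3 V"
    using commutator_opposite_blocks[OF V blk P'(1)] in1 x y yx block_diag_proj by blast+
  note s = sums_of_add[OF this]
  have W2: "z ** ?W' ** (?W ** w) = z ** w" for z w
    by (metis W matrix_mul_assoc matrix_mul_rid)
  have e: "y ** x ** ?e = y ** x" "?e ** (y ** x) = y ** x"
    using block_left block_right block_mult x y by blast+
  have "?W ** ?e ** (- (y ** x) ** ?W') = - (?W ** (?e ** (y ** x)) ** ?W')"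
    by (simp add: matrix_distribs matrix_mul_assoc)
  \<comment> \<open>The first commutator leaves \<open>- ?W ** y ** x ** ?W'\<close>, which the
    second cancels while contributing \<open>- (y ** x)\<close>.\<close>
  then have "x ** y - y ** x = ((x ** ?W') ** (?W ** y) - (?W ** y) ** (x ** ?W'))
     + ((- (y ** x) ** ?W') ** (?W ** ?e) - (?W ** ?e) ** (- (y ** x) ** ?W'))"
    by (simp add: W2 e matrix_mult_minus_left) (simp add: matrix_mul_assoc)
  with s show ?thesis by simp
qed

text \<open>Peirce decomposition: the diagonal corners of \<open>x ** y\<close> and of
  \<open>y ** x\<close> split into products over pairs \<open>(P, Q)\<close>, and interchanging
  \<open>P\<close> and \<open>Q\<close> in the second family matches them into commutators of
  opposite blocks.\<close>

lemma commutator_decomposition: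
  fixes x y :: "'b::ring_1 ^ 'n::finite ^ 'n"
  assumes "finite \<P>" and one: "(\<Sum>P\<in>\<P>. diag_proj P) = (mat 1 :: 'b ^ 'n ^ 'n)"
  shows "x ** y - y ** x =
    (\<Sum>(P, Q)\<in>\<P> \<times> \<P>. (if P = Q then 0 else diag_proj P ** (x ** y - y ** x) ** diag_proj Q)
       + ((diag_proj P ** x ** diag_proj Q) ** (diag_proj Q ** y ** diag_proj P)
        - (diag_proj Q ** y ** diag_proj P) ** (diag_proj P ** x ** diag_proj Q)))"
proof -
  let ?e = "diag_proj :: 'n set \<Rightarrow> 'b ^ 'n ^ 'n"
  define c where "c P Q z w = (?e P ** z ** ?e Q) ** (?e Q ** w ** ?e P)" for P Q z w
  have ee: "?e Q ** ?e Q = ?e Q" for Q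
    by (simp add: block_left[OF block_diag_proj])
  have c_sum: "?e P ** (z ** w) ** ?e P = (\<Sum>Q\<in>\<P>. c P Q z w)" for P z w
  proof -
    have "c P Q z w = ?e P ** z ** ?e Q ** (w ** ?e P)" for Q
      unfolding c_def by (metis ee matrix_mul_assoc)
    then have "(\<Sum>Q\<in>\<P>. c P Q z w) = (?e P ** z) ** (\<Sum>Q\<in>\<P>. ?e Q) ** (w ** ?e P)"
      by (simp add: matrix_mult_sum_left matrix_mult_sum_right matrix_mul_assoc)
    then show ?thesis by (simp add: one matrix_mul_assoc)
  qed
  let ?z = "x ** y - y ** x"
  have "?z = (\<Sum>P\<in>\<P>. ?e P) ** ?z ** (\<Sum>Q\<in>\<P>. ?e Q)"
    by (simp add: one)
  also have "\<dots> = (\<Sum>P\<in>\<P>. \<Sum>Q\<in>\<P>. ?e P ** ?z ** ?e Q)"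
    by (simp only: matrix_mult_sum_left matrix_mult_sum_right) (rule sum.swap)
  also have "\<dots> = (\<Sum>P\<in>\<P>. \<Sum>Q\<in>\<P>. (if P = Q then 0 else ?e P ** ?z ** ?e Q)
       + (if P = Q then ?e P ** ?z ** ?e Q else 0))"
    by (intro sum.cong) auto
  also have "\<dots> = (\<Sum>P\<in>\<P>. \<Sum>Q\<in>\<P>. if P = Q then 0 else ?e P ** ?z ** ?e Q)
       + (\<Sum>P\<in>\<P>. ?e P ** ?z ** ?e P)"
    using \<open>finite \<P>\<close> by (simp add: sum.distrib sum.delta)
  also have "(\<Sum>P\<in>\<P>. ?e P ** ?z ** ?e P) = (\<Sum>P\<in>\<P>. \<Sum>Q\<in>\<P>. c P Q x y) - (\<Sum>P\<in>\<P>. \<Sum>Q\<in>\<P>. c P Q y x)"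
    by (simp add: matrix_distribs c_sum sum_subtractf)
  also have "(\<Sum>P\<in>\<P>. \<Sum>Q\<in>\<P>. c P Q y x) = (\<Sum>P\<in>\<P>. \<Sum>Q\<in>\<P>. c Q P y x)"
    by (rule sum.swap)
  finally show ?thesis
    by (simp add: c_def sum.distrib sum_subtractf sum.cartesian_product split_beta)
qed

text \<open>The parts \<open>S\<close>, \<open>T\<close> and the rest give at most nine ordered
  pairs in the decomposition. A diagonal pair costs \<open>6 * 2\<close> differences, an
  off-diagonal one \<open>2 + 3 * 2\<close>, padded to 12; hence
  \<open>9 * 12 = 108\<close>.\<close>

lemma commutator_sum_of_differences:
  fixes a x y :: "'b::ring_1 ^ 'n::finite ^ 'n" and u :: 'b
  assumes I: "conj_closed I" "a \<in> I" and u: "u + u = 1"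
    and S: "S \<inter> T = {}" "card S = card T" "CARD('n) \<le> 3 * card S"
    and t: "t \<in> block S T" "t ** a ** diag_proj S = diag_proj S" "diag_proj T ** a ** t = diag_proj T"
  shows "x ** y - y ** x \<in> sums_of 108 (differences I)"
proof -
  let ?D = "differences I"
  let ?m = "card S"
  have cc: "conj_closed (sums_of k ?D)" for k
    using I conj_closed_sums_of conj_closed_differences by blast
  have D0: "0 \<in> ?D"
    using I(2) unfolding differences_def by force
  have blocks: "block Q R \<subseteq> sums_of 2 ?D" if "Q \<inter> R = {}" "card Q \<le> ?m" "card R \<le> ?m" for Q R
  proof (rule block_transport[OF cc _ S(1) that(1)])
    show "block S T \<subseteq> sums_of 2 ?D"
      using block_sum_of_two_differences[OF I u S(1) t] by (rule subsetI)
  qed (use that S(2) in simp_all)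
  have flat: "z \<in> sums_of (j * 2) ?D" if z: "z \<in> sums_of j (sums_of 2 ?D)" for z j
  proof -
    obtain s where "z = (\<Sum>i<j. s i)" "\<And>i. i < j \<Longrightarrow> s i \<in> sums_of 2 ?D"
      using sums_ofE[OF z] by blast
    then show ?thesis using sums_of_sum[of "{..<j}" s 2 ?D] by simp
  qed
  have cST: "card S + card T \<le> CARD('n)"
    using S(1) by (metis card_Un_disjoint card_mono finite subset_UNIV)
  \<comment> \<open>By \<open>CARD('n) \<le> 3 * card S\<close> the third part is no larger than
    \<open>S\<close>; as \<open>S\<close> and \<open>T\<close> are disjoint of equal size, no part
    exceeds half of the indices.\<close>
  define \<P> where "\<P> = {S, T, - (S \<union> T)}"
  have cR: "card (- (S \<union> T)) \<le> ?m"
    using S by (simp add: Compl_eq_Diff_UNIV card_Diff_subset card_Un_disjoint)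
  have P: "card P \<le> ?m" if "P \<in> \<P>" for P
    using that S(2) cR by (auto simp: \<P>_def)
  have P2: "2 * card P \<le> CARD('n)" if "P \<in> \<P>" for P
    using P[OF that] cST S(2) by linarith
  have disj: "P \<inter> Q = {}" if "P \<in> \<P>" "Q \<in> \<P>" "P \<noteq> Q" for P Q
    using that S(1) by (auto simp: \<P>_def)
  have fin: "finite \<P>" and card3: "card \<P> \<le> 3"
    by (auto simp: \<P>_def card_insert_if)
  have one: "(\<Sum>P\<in>\<P>. diag_proj P) = (mat 1 :: 'b ^ 'n ^ 'n)"
  proof -
    have "(\<Sum>P\<in>\<P>. diag_proj P $ i $ j) = (mat 1 :: 'b ^ 'n ^ 'n) $ i $ j" for i j
    proof -
      obtain P where iP: "P \<in> \<P>" "i \<in> P"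
        by (auto simp: \<P>_def)
      then have "(\<Sum>Q\<in>\<P>. diag_proj Q $ i $ j) = (\<Sum>Q\<in>\<P>. if Q = P then if i = j then 1 else 0 else (0 :: 'b))"
        using disj by (intro sum.cong) (auto simp: diag_proj_def)
      then show ?thesis using iP fin by (simp add: mat_def)
    qed
    then show ?thesis by (simp add: vec_eq_iff)
  qed
  let ?e = "diag_proj :: 'n set \<Rightarrow> 'b ^ 'n ^ 'n"
  have "(if P = Q then 0 else ?e P ** (x ** y - y ** x) ** ?e Q)
       + ((?e P ** x ** ?e Q) ** (?e Q ** y ** ?e P) - (?e Q ** y ** ?e P) ** (?e P ** x ** ?e Q))
     \<in> sums_of 12 ?D" if PQ: "P \<in> \<P>" "Q \<in> \<P>" for P Q
  proof (cases "P = Q")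
    case True
    then show ?thesis
      using flat[OF commutator_corner[OF cc blocks P P2 block_compress block_compress]] PQ by simp
  next
    case False
    have "?e P ** (x ** y - y ** x) ** ?e Q \<in> sums_of 2 ?D"
      using blocks[OF disj[OF PQ False]] P PQ block_compress by blast
    moreover have "(?e P ** x ** ?e Q) ** (?e Q ** y ** ?e P) - (?e Q ** y ** ?e P) ** (?e P ** x ** ?e Q)
        \<in> sums_of (3 * 2) ?D"
      by (rule flat[OF commutator_opposite_blocks[OF cc
            blocks[OF disj[OF PQ False] P[OF PQ(1)] P[OF PQ(2)]]
            blocks[OF disj[OF PQ(2,1) False[symmetric]] P[OF PQ(2)] P[OF PQ(1)]]
            disj[OF PQ False] block_compress block_compress]])
    ultimately have "?e P ** (x ** y - y ** x) ** ?e Q + ((?e P ** x ** ?e Q) ** (?e Q ** y ** ?e P)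
        - (?e Q ** y ** ?e P) ** (?e P ** x ** ?e Q)) \<in> sums_of (2 + 3 * 2) ?D"
      by (rule sums_of_add)
    then show ?thesis
      using False by (auto intro: sums_of_mono[OF D0])
  qed
  then have "x ** y - y ** x \<in> sums_of (card (\<P> \<times> \<P>) * 12) ?D"
    using fin by (subst commutator_decomposition[OF fin one]) (rule sums_of_sum, auto)
  moreover have "card (\<P> \<times> \<P>) * 12 \<le> 108"
    using mult_mono[OF card3 card3] by (simp add: card_cartesian_product)
  ultimately show ?thesis
    using sums_of_mono[OF D0] by blast
qed

section \<open>Evaluation of noncommutative polynomials\<close>

definition map_mat :: "('a \<Rightarrow> 'b) \<Rightarrow> 'a ^ 'n ^ 'm \<Rightarrow> 'b ^ 'n ^ 'm" where
  "map_mat h x = (\<chi> i j. h (x $ i $ j))"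

lemma map_mat_nth [simp]: "map_mat h x $ i $ j = h (x $ i $ j)"
  by (simp add: map_mat_def)

text \<open>Two instances matter: evaluation of polynomials at a point and the embedding of scalars
  \<open>smul c 1\<close> into \<open>B\<close>.\<close>

locale ring_1_hom =
  fixes h :: "'a::ring_1 \<Rightarrow> 'b::ring_1"
  assumes hom_add: "h (x + y) = h x + h y"
    and hom_mult: "h (x * y) = h x * h y"
    and hom_one: "h 1 = 1"
begin

lemma hom_zero [simp]: "h 0 = 0"
  using hom_add[of 0 0] by simp

lemma hom_sum: "h (sum g A) = (\<Sum>a\<in>A. h (g a))"
  by (induction A rule: infinite_finite_induct) (simp_all add: hom_add)

lemma map_mat_mult: "map_mat h (x ** y) = map_mat h x ** map_mat h y"
  by (simp add: vec_eq_iff matrix_matrix_mult_def hom_sum hom_mult)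

lemma map_mat_one: "map_mat h (mat 1) = mat 1"
  by (simp add: vec_eq_iff mat_def hom_one)

lemma map_mat_diag_proj: "map_mat h (diag_proj S) = diag_proj S"
  by (simp add: vec_eq_iff diag_proj_def hom_one)

lemma map_mat_prod_list: "map_mat h (mat_prod_list xs) = mat_prod_list (map (map_mat h) xs)"
  by (induction xs) (simp_all add: mat_prod_list_def map_mat_one map_mat_mult)

lemma map_mat_nc_eval:
  assumes "\<And>c x. h (s c x) = s' c (h x)"
  shows "map_mat h (nc_eval s f a) = nc_eval s' f (\<lambda>v. map_mat h (a v))"
proof -
  have "map_mat h (mat_prod_list (map a l)) = mat_prod_list (map (\<lambda>v. map_mat h (a v)) l)" for l
    by (simp add: map_mat_prod_list comp_def)
  then have "h (mat_prod_list (map a l) $ i $ j)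
      = mat_prod_list (map (\<lambda>v. map_mat h (a v)) l) $ i $ j" for l i j
    by (metis map_mat_nth)
  then show ?thesis
    by (simp add: nc_eval_def vec_eq_iff hom_sum mat_scale_def assms)
qed

end

lemma (in unital_algebra) mat_scale_mult:
  "mat_scale smul c x ** y = mat_scale smul c (x ** y)"
  "x ** mat_scale smul c y = mat_scale smul c (x ** y)"
  by (simp_all add: mat_scale_def vec_eq_iff matrix_matrix_mult_def scale_sum_right
      flip: smul_mult_left smul_mult_right)

lemma mat_prod_list_conj:
  assumes "g ** g' = mat 1" "g' ** g = mat 1"
  shows "g ** mat_prod_list xs ** g' = mat_prod_list (map (\<lambda>x. g ** x ** g') xs)"
proof (induction xs)
  case (Cons x xs)
  have "g ** (x ** mat_prod_list xs) ** g' = (g ** x ** g') ** (g ** mat_prod_list xs ** g')"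
    by (metis assms(2) matrix_mul_assoc matrix_mul_rid)
  with Cons show ?case by (simp add: mat_prod_list_def)
qed (simp add: mat_prod_list_def assms)

text \<open>Conjugation is an algebra automorphism, so conjugating a value amounts to conjugating
  the arguments.\<close>

lemma (in unital_algebra) conj_closed_nc_image:
  "conj_closed (nc_image smul f :: ('b ^ 'n ^ 'n) set)"
proof -
  have "g ** nc_eval smul f a ** g' = nc_eval smul f (\<lambda>v. g ** a v ** g')"
    if "g ** g' = mat 1" "g' ** g = mat 1" for g g' :: "'b ^ 'n ^ 'n" and a
  proof -
    have "g ** mat_scale smul c (mat_prod_list (map a l)) ** g'
        = mat_scale smul c (mat_prod_list (map (\<lambda>v. g ** a v ** g') l))" for c l
      using mat_prod_list_conj[OF that, of "map a l"]
      by (simp add: comp_def mat_scale_mult)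
    then show ?thesis
      by (simp add: nc_eval_def matrix_mult_sum_left matrix_mult_sum_right)
  qed
  then show ?thesis
    unfolding conj_closed_def nc_image_def by auto
qed

lemma (in unital_algebra) ring_1_hom_scalar: "ring_1_hom (\<lambda>c. smul c 1)"
  by unfold_locales (simp_all add: scale_left_distrib flip: smul_mult_left)

section \<open>Functions that are polynomial on every line\<close>

text \<open>Polynomiality on lines stands in for multivariate polynomials: it reduces nonvanishing
  to counting roots of univariate ones.\<close>

definition polyfun :: "(('n \<Rightarrow> 'f) \<Rightarrow> 'f::field) \<Rightarrow> bool" where
  "polyfun c \<longleftrightarrow> (\<forall>t u. \<exists>p. \<forall>s. c (\<lambda>i. t i + s * u i) = poly p s)"

lemma polyfunE:
  assumes "polyfun c"
  obtains p where "\<And>s. c (\<lambda>i. t i + s * u i) = poly p s"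
  using assms unfolding polyfun_def by blast

lemma polyfun_const: "polyfun (\<lambda>_. a)"
  unfolding polyfun_def by (intro allI exI[of _ "[:a:]"]) simp

lemma polyfun_poly_coordinate: "polyfun (\<lambda>t. poly q (t j))"
  unfolding polyfun_def
proof (intro allI)
  fix t u :: "'a \<Rightarrow> 'b"
  show "\<exists>p. \<forall>s. poly q (t j + s * u j) = poly p s"
    by (rule exI[of _ "pcompose q [:t j, u j:]"]) (simp add: poly_pcompose)
qed

lemma polyfun_add: "polyfun c \<Longrightarrow> polyfun c' \<Longrightarrow> polyfun (\<lambda>t. c t + c' t)"
  unfolding polyfun_def by (metis poly_add)

lemma polyfun_mult: "polyfun c \<Longrightarrow> polyfun c' \<Longrightarrow> polyfun (\<lambda>t. c t * c' t)"
  unfolding polyfun_def by (metis poly_mult)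

lemma polyfun_diff: "polyfun c \<Longrightarrow> polyfun c' \<Longrightarrow> polyfun (\<lambda>t. c t - c' t)"
  unfolding polyfun_def by (metis poly_diff)

lemma polyfun_sum: "(\<And>a. a \<in> A \<Longrightarrow> polyfun (c a)) \<Longrightarrow> polyfun (\<lambda>t. \<Sum>a\<in>A. c a t)"
  by (induction A rule: infinite_finite_induct) (simp_all add: polyfun_const polyfun_add)

text \<open>Induction on \<open>J\<close>: join a point where \<open>c j\<close> is nonzero to one
  where the product of the others is. On this line both are nonzero univariate polynomials, whose
  product has only finitely many roots.\<close>

lemma polyfun_common_nonzero:
  fixes c :: "'i \<Rightarrow> ('n \<Rightarrow> 'f::field) \<Rightarrow> 'f"
  assumes inf: "infinite (UNIV :: 'f set)" and "finite J"
    and "\<And>j. j \<in> J \<Longrightarrow> polyfun (c j)" "\<And>j. j \<in> J \<Longrightarrow> \<exists>t. c j t \<noteq> 0"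
  shows "\<exists>t. \<forall>j\<in>J. c j t \<noteq> 0"
proof -
  have "polyfun (\<lambda>t. \<Prod>j\<in>J. c j t) \<and> (\<exists>t. (\<Prod>j\<in>J. c j t) \<noteq> 0)"
    using assms(2-)
  proof (induction J rule: finite_induct)
    case empty
    then show ?case by (simp add: polyfun_const)
  next
    case (insert j J)
    let ?P = "\<lambda>t. \<Prod>j\<in>J. c j t"
    obtain t where "c j t \<noteq> 0"
      using insert.prems(2) by blast
    moreover obtain t' where "?P t' \<noteq> 0"
      using insert.IH insert.prems by blast
    ultimately have t: "c j t \<noteq> 0" "?P t' \<noteq> 0" .
    let ?l = "\<lambda>s i. t i + s * (t' i - t i)"
    have pf: "polyfun (c j)" "polyfun ?P"
      using insert by simp_all
    obtain p where p: "\<And>s. c j (?l s) = poly p s"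
      using polyfunE[OF pf(1), of t "\<lambda>i. t' i - t i"] by blast
    obtain q where q: "\<And>s. ?P (?l s) = poly q s"
      using polyfunE[OF pf(2), of t "\<lambda>i. t' i - t i"] by blast
    have "p \<noteq> 0"
      using p[of 0] t by auto
    moreover have "q \<noteq> 0"
      using q[of 1] t by auto
    ultimately have "finite {s. poly (p * q) s = 0}"
      by (intro poly_roots_finite) simp
    then obtain s where "poly (p * q) s \<noteq> 0"
      using inf by (metis (mono_tags, lifting) ex_new_if_finite mem_Collect_eq)
    then have "c j (?l s) * ?P (?l s) \<noteq> 0"
      by (simp add: p q)
    then show ?case
      using insert.hyps polyfun_mult[OF pf] by auto
  qed
  then show ?thesis
    using \<open>finite J\<close> by auto
qed

lemma ex_interpolating_poly:
  fixes t :: "'n \<Rightarrow> 'f::field"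
  assumes "finite A" "inj_on t A"
  shows "\<exists>p. \<forall>j\<in>A. poly p (t j) = g j"
  using assms
proof (induction A rule: finite_induct)
  case (insert i A)
  then obtain p where p: "\<forall>j\<in>A. poly p (t j) = g j" by auto
  let ?r = "\<Prod>j\<in>A. [:- t j, 1:]"
  have r: "poly ?r (t i) \<noteq> 0"
    using insert by (auto simp: poly_prod)
  have "poly ?r (t j) = 0" if "j \<in> A" for j
    using that insert by (auto simp: poly_prod)
  then have "\<forall>j\<in>insert i A. poly (p + smult ((g i - poly p (t i)) / poly ?r (t i)) ?r) (t j) = g j"
    using p r by auto
  then show ?case by blast
qed simp

section \<open>Cyclic permutations\<close>

lemma ex_cyclic_permutation:
  "\<exists>\<sigma> :: 'n::finite \<Rightarrow> 'n. bij \<sigma> \<and> (\<forall>i j. \<exists>k. i = (\<sigma> ^^ k) j)"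
proof -
  let ?N = "CARD('n)"
  have N: "0 < ?N" by simp
  obtain h where h: "bij_betw h {0..<?N} (UNIV :: 'n set)"
    using ex_bij_betw_nat_finite[of "UNIV :: 'n set"] by auto
  define g where "g = inv_into {0..<?N} h"
  have gh: "g (h m) = m" if "m < ?N" for m
    using h that by (simp add: g_def bij_betw_inv_into_left)
  have hg: "h (g i) = i" and gN: "g i < ?N" for i
    using h bij_betw_inv_into_right[OF h] bij_betw_inv_into[OF h] 
    by (auto simp: g_def bij_betw_def) 
  define \<sigma> where "\<sigma> i = h ((g i + 1) mod ?N)" for i
  have pow: "(\<sigma> ^^ k) i = h ((g i + k) mod ?N)" for k i
    by (induction k) (simp_all add: gN hg, simp add: \<sigma>_def gh mod_Suc_eq)
  \<comment> \<open>Writing the exponent as a successor lets the case \<open>i = j\<close> exhibit a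
    preimage of \<open>i\<close>, hence surjectivity.\<close>
  have trans: "i = (\<sigma> ^^ Suc (g i + (?N - Suc (g j)))) j" for i j
  proof -
    have "g j + Suc (g i + (?N - Suc (g j))) = g i + ?N"
      using gN[of j] by simp
    then show ?thesis
      by (simp only: pow) (simp add: gN hg)
  qed
  have "surj \<sigma>"
  proof (rule surjI)
    fix i show "\<sigma> ((\<sigma> ^^ (g i + (?N - Suc (g i)))) i) = i"
      using trans[of i i] by simp
  qed
  then have "bij \<sigma>"
    by (simp add: bij_def finite_UNIV_surj_inj)
  with trans show ?thesis by blast
qed

text \<open>A set that is maximal with respect to being disjoint from its image satisfies
  \<open>S \<union> \<pi> ` S \<union> \<pi> -` S = UNIV\<close>.\<close>

lemma ex_large_set_disjoint_from_image:
  fixes \<pi> :: "'n::finite \<Rightarrow> 'n"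
  assumes "bij \<pi>" "\<And>x. \<pi> x \<noteq> x"
  shows "\<exists>S. S \<inter> \<pi> ` S = {} \<and> CARD('n) \<le> 3 * card S"
proof -
  let ?Q = "\<lambda>S. S \<inter> \<pi> ` S = {}"
  have "finite {S. ?Q S}" "{} \<in> {S. ?Q S}" by auto
  then obtain S where S: "?Q S" and max: "\<And>S'. ?Q S' \<Longrightarrow> S \<subseteq> S' \<Longrightarrow> S' = S"
    using finite_has_maximal2[of "{S. ?Q S}" "{}"] by (metis (mono_tags, lifting) mem_Collect_eq)
  have "x \<in> S \<union> \<pi> ` S \<union> \<pi> -` S" for x
  proof (rule ccontr)
    assume x: "x \<notin> S \<union> \<pi> ` S \<union> \<pi> -` S"
    then have "x \<noteq> \<pi> x" "x \<notin> \<pi> ` S" "\<pi> x \<notin> S" "x \<notin> S"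
      using assms(2)[of x] by (simp_all add: eq_commute)
    then have "?Q (insert x S)"
      using S by simp
    then have "insert x S = S"
      by (rule max) (rule subset_insertI)
    with \<open>x \<notin> S\<close> show False by blast
  qed
  then have "UNIV = S \<union> \<pi> ` S \<union> \<pi> -` S" by blast
  then have "CARD('n) \<le> card S + card (\<pi> ` S) + card (\<pi> -` S)"
    by (metis card_Un_le add_le_mono1 le_trans)
  also have "card (\<pi> ` S) = card S"
    by (rule card_image[OF inj_on_subset[OF bij_is_inj[OF assms(1)] subset_UNIV]])
  also have "card (\<pi> -` S) = card S"
    using assms(1) by (simp add: card_vimage_inj bij_is_inj bij_is_surj)
  finally show ?thesis
    using S by (intro exI[of _ S]) simp
qed

section \<open>Cyclic families of polynomial matrices\<close>

text \<open>These families form a copy of the skew polynomial ring \<open>K[x; \<sigma>]\<close> over the ring \<open>K\<close> of polynomial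
  functions of \<open>t\<close>: the indeterminate \<open>x\<close> is the permutation matrix of \<open>\<sigma>\<close> times the scalar
  indeterminate.  The degree in that indeterminate is thus tied to the cyclic diagonals of the
  matrix.\<close>

definition cyclic_family ::
  "('n \<Rightarrow> 'n) \<Rightarrow> (('n \<Rightarrow> 'f::field) \<Rightarrow> 'f poly ^ 'n ^ 'n) \<Rightarrow> bool" where
  "cyclic_family \<sigma> M \<longleftrightarrow>
     (\<forall>t i j k. coeff (M t $ i $ j) k \<noteq> 0 \<longrightarrow> i = (\<sigma> ^^ k) j) \<and>
     (\<forall>t i j. M (t \<circ> \<sigma>) $ i $ j = M t $ \<sigma> i $ \<sigma> j) \<and>
     (\<forall>i j k. polyfun (\<lambda>t. coeff (M t $ i $ j) k))"

lemma cyclic_family_one: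
  fixes \<sigma> :: "'n::finite \<Rightarrow> 'n"
  assumes "bij \<sigma>"
  shows "cyclic_family \<sigma> (\<lambda>_. mat 1 :: 'f::field poly ^ 'n ^ 'n)"
  unfolding cyclic_family_def
proof (intro conjI allI impI)
  fix i j :: 'n and k
  assume "coeff ((mat 1 :: 'f poly ^ 'n ^ 'n) $ i $ j) k \<noteq> 0"
  then show "i = (\<sigma> ^^ k) j"
    by (auto simp: mat_def coeff_1 split: if_splits)
qed (use assms in \<open>auto simp: mat_def polyfun_const bij_def inj_eq\<close>)

text \<open>Degrees add, and so do the shifts: \<open>\<sigma> ^^ r\<close> after
  \<open>\<sigma> ^^ (k - r)\<close> is \<open>\<sigma> ^^ k\<close>. Equivariance follows by
  reindexing the inner sum along \<open>\<sigma>\<close>.\<close>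

lemma cyclic_family_mult:
  fixes \<sigma> :: "'n::finite \<Rightarrow> 'n" and M M' :: "('n \<Rightarrow> 'f::field) \<Rightarrow> 'f poly ^ 'n ^ 'n"
  assumes "bij \<sigma>" and M: "cyclic_family \<sigma> M" and M': "cyclic_family \<sigma> M'"
  shows "cyclic_family \<sigma> (\<lambda>t. M t ** M' t)"
  unfolding cyclic_family_def
proof (intro conjI allI impI)
  fix t :: "'n \<Rightarrow> 'f" and i j k
  assume "coeff ((M t ** M' t) $ i $ j) k \<noteq> 0"
  then have "(\<Sum>l\<in>UNIV. \<Sum>r\<le>k. coeff (M t $ i $ l) r * coeff (M' t $ l $ j) (k - r)) \<noteq> 0"
    by (simp add: matrix_matrix_mult_def coeff_sum coeff_mult)
  then obtain l where "(\<Sum>r\<le>k. coeff (M t $ i $ l) r * coeff (M' t $ l $ j) (k - r)) \<noteq> 0"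
    by (meson sum.neutral)
  then obtain r where r: "r \<le> k" "coeff (M t $ i $ l) r * coeff (M' t $ l $ j) (k - r) \<noteq> 0"
    by (meson sum.neutral atMost_iff)
  then have "i = (\<sigma> ^^ r) l" "l = (\<sigma> ^^ (k - r)) j"
    using M M' by (auto simp: cyclic_family_def)
  then show "i = (\<sigma> ^^ k) j"
    using r(1) by (simp flip: funpow_add[THEN fun_cong, unfolded comp_def])
next
  fix t :: "'n \<Rightarrow> 'f" and i j
  have "(M (t \<circ> \<sigma>) ** M' (t \<circ> \<sigma>)) $ i $ j = (\<Sum>l\<in>UNIV. M t $ \<sigma> i $ \<sigma> l * M' t $ \<sigma> l $ \<sigma> j)"
    using M M' by (simp add: matrix_matrix_mult_def cyclic_family_def)
  also have "\<dots> = (\<Sum>l\<in>UNIV. M t $ \<sigma> i $ l * M' t $ l $ \<sigma> j)"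
    using assms(1) by (rule sum.reindex_bij_betw)
  finally show "(M (t \<circ> \<sigma>) ** M' (t \<circ> \<sigma>)) $ i $ j = (M t ** M' t) $ \<sigma> i $ \<sigma> j"
    by (simp add: matrix_matrix_mult_def)
next
  fix i j k
  show "polyfun (\<lambda>t. coeff ((M t ** M' t) $ i $ j) k)"
    using M M' unfolding cyclic_family_def
    by (simp add: matrix_matrix_mult_def coeff_sum coeff_mult polyfun_sum polyfun_mult)
qed

lemma cyclic_family_scale:
  "cyclic_family \<sigma> M \<Longrightarrow> cyclic_family \<sigma> (\<lambda>t. mat_scale smult c (M t))"
  unfolding cyclic_family_def by (auto simp: mat_scale_def intro!: polyfun_mult polyfun_const)

lemma cyclic_family_sum:
  assumes "\<And>a. a \<in> A \<Longrightarrow> cyclic_family \<sigma> (M a)"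
  shows "cyclic_family \<sigma> (\<lambda>t. \<Sum>a\<in>A. M a t)"
  unfolding cyclic_family_def
proof (intro conjI allI impI)
  fix t i j k
  assume "coeff ((\<Sum>a\<in>A. M a t) $ i $ j) k \<noteq> 0"
  then obtain a where "a \<in> A" "coeff (M a t $ i $ j) k \<noteq> 0"
    by (auto simp: coeff_sum dest: sum.not_neutral_contains_not_neutral)
  then show "i = (\<sigma> ^^ k) j"
    using assms by (auto simp: cyclic_family_def)
qed (use assms in \<open>auto simp: cyclic_family_def coeff_sum intro!: polyfun_sum\<close>)

lemma cyclic_family_nc_eval:
  fixes \<sigma> :: "'n::finite \<Rightarrow> 'n" and f :: "'f::field free_algebra"
  assumes "bij \<sigma>" "\<And>v. cyclic_family \<sigma> (d v)"
  shows "cyclic_family \<sigma> (\<lambda>t. nc_eval smult f (\<lambda>v. d v t))"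
proof -
  have "cyclic_family \<sigma> (\<lambda>t. mat_prod_list (map (\<lambda>v. d v t) l))" for l
    by (induction l)
      (simp_all add: mat_prod_list_def cyclic_family_one cyclic_family_mult assms)
  then show ?thesis
    unfolding nc_eval_def by (intro cyclic_family_sum cyclic_family_scale)
qed

text \<open>Shifting the argument shifts the index, so transitivity spreads nonvanishing from one
  index to all; genericity then gives a common point.\<close>

lemma cyclic_common_nonzero:
  fixes \<sigma> :: "'n::finite \<Rightarrow> 'n" and c :: "'n \<Rightarrow> ('n \<Rightarrow> 'f::field) \<Rightarrow> 'f"
  assumes inf: "infinite (UNIV :: 'f set)" and \<sigma>: "bij \<sigma>" "\<And>i j. \<exists>k. i = (\<sigma> ^^ k) j"
    and c: "\<And>j. polyfun (c j)" "\<And>j t. c (\<sigma> j) t = c j (t \<circ> \<sigma>)" and nz: "c j t \<noteq> 0"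
  shows "\<exists>t. \<forall>j. c j t \<noteq> 0"
proof -
  have pow: "c ((\<sigma> ^^ k) j) t = c j (t \<circ> (\<sigma> ^^ k))" for k j t
    by (induction k arbitrary: t) (simp_all add: c comp_assoc)
  have "\<exists>t. c i t \<noteq> 0" for i
  proof -
    obtain k where k: "i = (\<sigma> ^^ k) j" using \<sigma>(2) by blast
    have "inj (\<sigma> ^^ k)"
      using \<sigma>(1) by (simp add: bij_is_inj inj_fn)
    then have "c i (t \<circ> inv (\<sigma> ^^ k)) = c j t"
      by (simp add: k pow comp_assoc)
    with nz show ?thesis by metis
  qed
  then show ?thesis
    using polyfun_common_nonzero[OF inf finite[of UNIV], of c] c(1) by simp
qed

text \<open>Entry \<open>(i, j)\<close> is a monomial of degree \<open>\<kappa> i j\<close>, which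
  depends only on the cyclic diagonal, with a coefficient polynomial in \<open>t j\<close>. As the
  \<open>t\<^sub>0 j\<close> are distinct, one interpolating polynomial serves a whole diagonal, and
  this makes the family equivariant.\<close>

lemma ex_cyclic_family_through:
  fixes \<sigma> :: "'n::finite \<Rightarrow> 'n" and t\<^sub>0 :: "'n \<Rightarrow> 'f::field" and x :: "'f ^ 'n ^ 'n"
  assumes \<sigma>: "bij \<sigma>" "\<And>i j. \<exists>k. i = (\<sigma> ^^ k) j" and "inj t\<^sub>0"
  shows "\<exists>d. cyclic_family \<sigma> d \<and> map_mat (\<lambda>p. poly p 1) (d t\<^sub>0) = x"
proof -
  define \<kappa> where "\<kappa> i j = (LEAST k. i = (\<sigma> ^^ k) j)" for i j
  have \<kappa>: "(\<sigma> ^^ \<kappa> i j) j = i" for i j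
    unfolding \<kappa>_def by (metis (mono_tags, lifting) LeastI_ex \<sigma>(2))
  have "\<sigma> i = (\<sigma> ^^ k) (\<sigma> j) \<longleftrightarrow> i = (\<sigma> ^^ k) j" for i j k
    using \<sigma>(1) by (metis bij_is_inj funpow_swap1 inj_eq)
  then have \<kappa>\<sigma>: "\<kappa> (\<sigma> i) (\<sigma> j) = \<kappa> i j" for i j
    by (simp add: \<kappa>_def)
  have "\<exists>p. \<forall>j\<in>UNIV. poly p (t\<^sub>0 j) = x $ ((\<sigma> ^^ k) j) $ j" for k
    by (rule ex_interpolating_poly[OF finite \<open>inj t\<^sub>0\<close>])
  then obtain q where q: "\<And>k j. poly (q k) (t\<^sub>0 j) = x $ ((\<sigma> ^^ k) j) $ j"
    by (metis UNIV_I)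
  define d where "d t = (\<chi> i j. monom (poly (q (\<kappa> i j)) (t j)) (\<kappa> i j))" for t :: "'n \<Rightarrow> 'f"
  have "polyfun (\<lambda>t. if \<kappa> i j = k then poly (q (\<kappa> i j)) (t j) else 0)" for i j k
    by (cases "\<kappa> i j = k") (simp_all add: polyfun_poly_coordinate polyfun_const)
  then have "cyclic_family \<sigma> d"
    unfolding cyclic_family_def d_def by (auto simp: \<kappa> \<kappa>\<sigma> split: if_splits)
  moreover have "map_mat (\<lambda>p. poly p 1) (d t\<^sub>0) = x"
    by (simp add: vec_eq_iff d_def poly_monom q \<kappa>)
  ultimately show ?thesis by blast
qed

section \<open>A value with a large invertible off-diagonal minor\<close>

text \<open>The completion by a unit block avoids determinants of varying size.\<close>

definition minor_mat :: "('n \<Rightarrow> 'n) \<Rightarrow> 'n set \<Rightarrow> 'b::ring_1 ^ 'n ^ 'n \<Rightarrow> 'b ^ 'n ^ 'n" where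
  "minor_mat \<pi> S a =
     (\<chi> i j. if i \<in> S \<and> j \<in> S then a $ \<pi> i $ j else if i = j then 1 else 0)"

text \<open>The completed minor is block diagonal with respect to \<open>S\<close>, hence so is its
  inverse \<open>G\<close>. Cutting \<open>G\<close> to the corner of \<open>S\<close> and moving
  the columns along \<open>\<pi>\<close> gives \<open>t\<close>.\<close>

lemma minor_mat_inverse:
  fixes a :: "'f::field ^ 'n::finite ^ 'n"
  assumes \<pi>: "bij \<pi>" and det: "det (minor_mat \<pi> S a) \<noteq> 0"
  shows "\<exists>t \<in> block S (\<pi> ` S). t ** a ** diag_proj S = diag_proj S \<and>
           diag_proj (\<pi> ` S) ** a ** t = diag_proj (\<pi> ` S)"
proof -
  let ?H = "minor_mat \<pi> S a" and ?e = "diag_proj S :: 'f ^ 'n ^ 'n"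
    and ?eT = "diag_proj (\<pi> ` S) :: 'f ^ 'n ^ 'n"
    and ?W = "perm_mat \<pi> :: 'f ^ 'n ^ 'n" and ?W' = "perm_mat (inv \<pi>) :: 'f ^ 'n ^ 'n"
  obtain G where G: "?H ** G = mat 1" "G ** ?H = mat 1"
    using det by (metis invertible_det_nz invertible_def)
  have inv\<pi>: "bij (inv \<pi>)" "inv (inv \<pi>) = \<pi>"
    using \<pi> by (simp_all add: bij_imp_bij_inv inv_inv_eq)
  have He: "?H ** ?e = ?e ** ?H"
    by (auto simp: vec_eq_iff minor_mat_def)
  have Ge: "G ** ?e = ?e ** G"
    by (metis G He matrix_mul_assoc matrix_mul_lid matrix_mul_rid)
  have ee: "?e ** ?e = ?e"
    by (simp add: block_left[OF block_diag_proj])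
  have eWae: "?e ** ?W' ** a ** ?e = ?e ** ?H"
    by (auto simp: vec_eq_iff minor_mat_def perm_mat_mult inv\<pi> simp flip: matrix_mul_assoc)
  have eW: "?e ** ?W' = ?W' ** ?eT"
  proof -
    have "(?e ** ?W') $ i $ j = (?W' ** ?eT) $ i $ j" for i j
      using \<pi> unfolding diag_proj_mult mult_diag_proj
      by (auto simp: perm_mat_def bij_is_surj surj_f_inv_f bij_is_inj inv_f_f image_iff intro!: bexI[of _ "inv \<pi> j"])
    then show ?thesis by (simp add: vec_eq_iff)
  qed
  have WW: "?W ** ?W' = mat 1"
    using perm_mat_inverse \<pi> by blast
  define t where "t = G ** ?e ** ?W'"
  have "t ** a ** ?e = G ** (?e ** ?W' ** a ** ?e)"
    by (simp add: t_def matrix_mul_assoc)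
  also have "\<dots> = ?e"
    unfolding eWae by (metis G(2) He matrix_mul_assoc matrix_mul_lid)
  finally have 1: "t ** a ** ?e = ?e" .
  have eT: "?eT = ?W ** (?e ** ?W')"
    by (metis eW WW matrix_mul_assoc matrix_mul_lid)
  have "?eT ** a ** t = ?W ** (?e ** ?W' ** a ** ?e) ** (G ** ?W')"
    unfolding eT t_def Ge by (simp add: matrix_mul_assoc)
  also have "\<dots> = ?W ** ?e ** (?H ** G) ** ?W'"
    unfolding eWae by (simp add: matrix_mul_assoc)
  also have "\<dots> = ?eT"
    by (simp add: G eT matrix_mul_assoc)
  finally have 2: "?eT ** a ** t = ?eT" .
  have "t \<in> block S (\<pi> ` S)"
    unfolding block_iff
    by (metis Ge block_left[OF block_diag_proj] eW ee matrix_mul_assoc t_def)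
  with 1 2 show ?thesis by blast
qed

lemma poly_det: "poly (det P) y = det (map_mat (\<lambda>p. poly p y) P)"
  for P :: "'f::comm_ring_1 poly ^ 'n ^ 'n"
  unfolding det_def by (simp add: poly_sum poly_prod)

lemma map_mat_minor_mat:
  "map_mat (\<lambda>p. poly p y) (minor_mat \<pi> S P) = minor_mat \<pi> S (map_mat (\<lambda>p. poly p y) P)"
  by (auto simp: vec_eq_iff minor_mat_def)

text \<open>The lowest off-diagonal coefficient of \<open>M\<close> sits on one cyclic diagonal and, by cyclicity and
  genericity of \<open>t\<close>, has no zero there.  Coefficients of other degrees only enter a minor with disjoint
  rows and columns in higher degree.\<close>

lemma cyclic_family_off_diagonal:
  fixes \<sigma> :: "'n::finite \<Rightarrow> 'n" and M :: "('n \<Rightarrow> 'f::field) \<Rightarrow> 'f poly ^ 'n ^ 'n"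
  assumes inf: "infinite (UNIV :: 'f set)" and \<sigma>: "bij \<sigma>" "\<And>i j. \<exists>k. i = (\<sigma> ^^ k) j"
    and M: "cyclic_family \<sigma> M" and off: "i\<^sub>0 \<noteq> j\<^sub>0" "M t\<^sub>0 $ i\<^sub>0 $ j\<^sub>0 \<noteq> 0"
  shows "\<exists>t y \<pi> S. bij \<pi> \<and> S \<inter> \<pi> ` S = {} \<and> CARD('n) \<le> 3 * card S \<and>
           det (minor_mat \<pi> S (map_mat (\<lambda>p. poly p y) (M t))) \<noteq> 0"
proof -
  define R where "R k \<longleftrightarrow> (\<exists>t i j. i \<noteq> j \<and> coeff (M t $ i $ j) k \<noteq> 0)" for k
  have "\<exists>k. R k"
    using off by (auto simp: R_def poly_eq_iff)
  \<comment> \<open>The degree is minimal over all off-diagonal entries and all \<open>t\<close> at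
    once, so that \<open>low\<close> also holds at the generic point chosen later.\<close>
  define k where "k = (LEAST k. R k)"
  have "R k" unfolding k_def using \<open>\<exists>k. R k\<close> by (rule LeastI_ex)
  then obtain t\<^sub>1 i\<^sub>1 j\<^sub>1 where ij: "i\<^sub>1 \<noteq> j\<^sub>1" "coeff (M t\<^sub>1 $ i\<^sub>1 $ j\<^sub>1) k \<noteq> 0"
    by (auto simp: R_def)
  have low: "coeff (M t $ i $ j) r = 0" if "r < k" "i \<noteq> j" for t i j r
    using not_less_Least[of r R] that by (auto simp: k_def R_def)
  define \<pi> where "\<pi> = \<sigma> ^^ k"
  have supp: "i = \<pi> j" if "coeff (M t $ i $ j) k \<noteq> 0" for t i j
    using M that by (auto simp: cyclic_family_def \<pi>_def)
  have \<pi>: "bij \<pi>"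
    using \<sigma>(1) by (simp add: \<pi>_def bij_fn)
  have comm: "\<pi> ((\<sigma> ^^ r) j) = (\<sigma> ^^ r) (\<pi> j)" for r j
    by (simp add: \<pi>_def flip: funpow_add[THEN fun_cong, unfolded comp_def]) (simp add: add.commute)
  \<comment> \<open>\<open>\<pi>\<close> commutes with the powers of \<open>\<sigma>\<close>, which
    act transitively, so one fixed point would make \<open>j\<^sub>1\<close> fixed too.\<close>
  have nofix: "\<pi> x \<noteq> x" for x
  proof
    assume "\<pi> x = x"
    obtain r where "j\<^sub>1 = (\<sigma> ^^ r) x" using \<sigma>(2) by blast
    then have "\<pi> j\<^sub>1 = j\<^sub>1"
      using comm \<open>\<pi> x = x\<close> by simp
    with ij supp show False by blast
  qed
  obtain S where S: "S \<inter> \<pi> ` S = {}" "CARD('n) \<le> 3 * card S"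
    using ex_large_set_disjoint_from_image[OF \<pi> nofix] by blast
  have "\<exists>t. \<forall>j. coeff (M t $ \<pi> j $ j) k \<noteq> 0"
  proof (rule cyclic_common_nonzero[OF inf \<sigma>])
    show "polyfun (\<lambda>t. coeff (M t $ \<pi> j $ j) k)" for j
      using M by (simp add: cyclic_family_def)
    show "coeff (M t $ \<pi> (\<sigma> j) $ \<sigma> j) k = coeff (M (t \<circ> \<sigma>) $ \<pi> j $ j) k" for j t
      using M comm[of 1 j] by (simp add: cyclic_family_def)
    show "coeff (M t\<^sub>1 $ \<pi> j\<^sub>1 $ j\<^sub>1) k \<noteq> 0"
      using ij supp by metis
  qed
  then obtain t where t: "\<And>j. coeff (M t $ \<pi> j $ j) k \<noteq> 0" by blast
  \<comment> \<open>\<open>P\<close> is the completed minor with \<open>monom 1 k\<close> divided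
    out of each row in \<open>S\<close>; at 0 it becomes diagonal with nonzero entries.\<close>
  define P where "P = (\<chi> i j. if i \<in> S \<and> j \<in> S then poly_shift k (M t $ \<pi> i $ j)
    else if i = j then 1 else 0)"
  have shift: "monom 1 k * poly_shift k (M t $ \<pi> i $ j) = M t $ \<pi> i $ j" if "i \<in> S" "j \<in> S" for i j
  proof -
    have "\<pi> i \<noteq> j" using S that by auto
    then show ?thesis
      using low by (auto simp: poly_eq_iff coeff_monom_mult coeff_poly_shift)
  qed
  have "minor_mat \<pi> S (M t) = (\<chi> i. (if i \<in> S then monom 1 k else 1) *s P $ i)"
    by (auto simp: vec_eq_iff minor_mat_def P_def shift)
  then have "det (minor_mat \<pi> S (M t)) = (\<Prod>i\<in>UNIV. if i \<in> S then monom 1 k else 1) * det P"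
    by (simp add: det_rows_mul)
  moreover have "poly (det P) 0 \<noteq> 0"
  proof -
    have *: "poly (P $ i $ j) 0 = (if i = j then if i \<in> S then coeff (M t $ \<pi> i $ i) k else 1 else 0)" for i j
      using supp[of t "\<pi> i" j] \<pi>
      by (auto simp: P_def poly_0_coeff_0 coeff_poly_shift bij_def inj_eq)
    show ?thesis
      unfolding poly_det by (subst det_diagonal) (auto simp: * t)
  qed
  ultimately have "det (minor_mat \<pi> S (M t)) \<noteq> 0"
    by (auto simp: prod_zero_iff monom_eq_0_iff split: if_splits)
  then have "finite {y. poly (det (minor_mat \<pi> S (M t))) y = 0}"
    by (rule poly_roots_finite)
  then obtain y where "poly (det (minor_mat \<pi> S (M t))) y \<noteq> 0"
    using inf by (metis (mono_tags, lifting) ex_new_if_finite mem_Collect_eq)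
  then have "det (minor_mat \<pi> S (map_mat (\<lambda>p. poly p y) (M t))) \<noteq> 0"
    by (simp add: poly_det map_mat_minor_mat)
  with \<pi> S show ?thesis by blast
qed

text \<open>A noncentral diagonal matrix has unequal diagonal entries, hence by transitivity two
  that differ across one step of \<open>\<sigma>\<close>; generically this holds at every step.
  Conjugation by \<open>1 + w\<close>, with \<open>w\<close> moving \<open>S\<close> to its image,
  puts these differences on the diagonal of a minor.\<close>

lemma cyclic_family_diagonal:
  fixes \<sigma> :: "'n::finite \<Rightarrow> 'n" and M :: "('n \<Rightarrow> 'f::field) \<Rightarrow> 'f poly ^ 'n ^ 'n"
  assumes inf: "infinite (UNIV :: 'f set)" and \<sigma>: "bij \<sigma>" "\<And>i j. \<exists>k. i = (\<sigma> ^^ k) j"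
    and M: "cyclic_family \<sigma> M" and diag: "\<And>t i j. i \<noteq> j \<Longrightarrow> M t $ i $ j = 0"
    and noncentral: "map_mat (\<lambda>p. poly p 1) (M t\<^sub>0) \<notin> mat_center"
  shows "\<exists>t y (g :: 'f ^ 'n ^ 'n) g' \<pi> S. g ** g' = mat 1 \<and> g' ** g = mat 1 \<and>
           bij \<pi> \<and> S \<inter> \<pi> ` S = {} \<and> CARD('n) \<le> 3 * card S \<and>
           det (minor_mat \<pi> S (g ** map_mat (\<lambda>p. poly p y) (M t) ** g')) \<noteq> 0"
proof -
  have "\<exists>j. M t\<^sub>0 $ j $ j \<noteq> M t\<^sub>0 $ \<sigma> j $ \<sigma> j"
  proof (rule ccontr)
    assume "\<nexists>j. M t\<^sub>0 $ j $ j \<noteq> M t\<^sub>0 $ \<sigma> j $ \<sigma> j"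
    then have "M t\<^sub>0 $ (\<sigma> ^^ k) j $ (\<sigma> ^^ k) j = M t\<^sub>0 $ j $ j" for k j
      by (induction k) simp_all
    then have eq: "M t\<^sub>0 $ i $ i = M t\<^sub>0 $ j $ j" for i j
      using \<sigma>(2)[of i j] by auto
    have "map_mat (\<lambda>p. poly p 1) (M t\<^sub>0) = mat (poly (M t\<^sub>0 $ undefined $ undefined) 1)"
      using diag by (auto simp: vec_eq_iff mat_def) (metis eq)
    moreover have "mat c ** x = x ** mat c" for c and x :: "'f ^ 'n ^ 'n"
      by (simp add: vec_eq_iff matrix_matrix_mult_def mat_def if_distrib if_distribR
          sum.delta sum.delta' mult.commute cong: if_cong)
    ultimately show False
      using noncentral by (auto simp: mat_center_def)
  qed
  then obtain j\<^sub>1 k where jk: "coeff (M t\<^sub>0 $ j\<^sub>1 $ j\<^sub>1) k \<noteq> coeff (M t\<^sub>0 $ \<sigma> j\<^sub>1 $ \<sigma> j\<^sub>1) k"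
    by (auto simp: poly_eq_iff)
  have "\<exists>t. \<forall>j. coeff (M t $ j $ j) k - coeff (M t $ \<sigma> j $ \<sigma> j) k \<noteq> 0"
  proof (rule cyclic_common_nonzero[OF inf \<sigma>])
    show "polyfun (\<lambda>t. coeff (M t $ j $ j) k - coeff (M t $ \<sigma> j $ \<sigma> j) k)" for j
      using M by (intro polyfun_diff) (auto simp: cyclic_family_def)
    show "coeff (M t $ \<sigma> j $ \<sigma> j) k - coeff (M t $ \<sigma> (\<sigma> j) $ \<sigma> (\<sigma> j)) k
        = coeff (M (t \<circ> \<sigma>) $ j $ j) k - coeff (M (t \<circ> \<sigma>) $ \<sigma> j $ \<sigma> j) k" for j t
      using M by (simp add: cyclic_family_def)
    show "coeff (M t\<^sub>0 $ j\<^sub>1 $ j\<^sub>1) k - coeff (M t\<^sub>0 $ \<sigma> j\<^sub>1 $ \<sigma> j\<^sub>1) k \<noteq> 0"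
      using jk by simp
  qed
  then obtain t where t: "\<And>j. M t $ j $ j \<noteq> M t $ \<sigma> j $ \<sigma> j"
    by (metis diff_self)
  then have nofix: "\<sigma> x \<noteq> x" for x by metis
  obtain S where S: "S \<inter> \<sigma> ` S = {}" "CARD('n) \<le> 3 * card S"
    using ex_large_set_disjoint_from_image[OF \<sigma>(1) nofix] by blast
  let ?p = "\<Prod>j\<in>UNIV. (M t $ j $ j - M t $ \<sigma> j $ \<sigma> j)"
  have "finite {y. poly ?p y = 0}"
    using t by (intro poly_roots_finite) simp
  then obtain y where y: "poly ?p y \<noteq> 0"
    using inf by (metis (mono_tags, lifting) ex_new_if_finite mem_Collect_eq)
  define a where "a = map_mat (\<lambda>p. poly p y) (M t)"
  have a: "a $ j $ j \<noteq> a $ \<sigma> j $ \<sigma> j" for j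
    using y by (auto simp: poly_prod a_def)
  have a0: "a $ i $ j = 0" if "i \<noteq> j" for i j
    using diag that by (simp add: a_def)
  define w :: "'f ^ 'n ^ 'n" where "w = perm_mat \<sigma> ** diag_proj S"
  have wl: "(w ** x) $ \<sigma> i $ j = (if i \<in> S then x $ i $ j else 0)" for x i j
    using \<sigma>(1) by (simp add: w_def perm_mat_mult bij_is_inj inv_f_f flip: matrix_mul_assoc)
  have wr: "(x ** w) $ i $ j = (if j \<in> S then x $ i $ \<sigma> j else 0)" for x i j
    by (simp add: w_def mult_perm_mat matrix_mul_assoc)
  have "w \<in> block (\<sigma> ` S) S"
    unfolding w_def by (intro perm_mat_block \<sigma> block_diag_proj)
  then have ww: "w ** w = 0"
    using block_mult_disjoint S(1) by blast
  have b: "(mat 1 + w) ** a ** (mat 1 - w) = a + w ** a - a ** w - w ** a ** w"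
    by (simp add: matrix_distribs algebra_simps)
  have entry: "((mat 1 + w) ** a ** (mat 1 - w)) $ \<sigma> i $ j
      = (if i = j then a $ j $ j - a $ \<sigma> j $ \<sigma> j else 0)" if "i \<in> S" "j \<in> S" for i j
  proof -
    \<comment> \<open>Disjointness of \<open>S\<close> and its image kills \<open>a\<close> and
      \<open>w ** a ** w\<close> at this position; \<open>w ** a\<close> and \<open>a ** w\<close>
      supply the two diagonal entries.\<close>
    have ne: "\<sigma> i \<noteq> j" "i \<noteq> \<sigma> j" using S that by auto
    have "\<sigma> i = \<sigma> j \<longleftrightarrow> i = j" using \<sigma>(1) by (simp add: bij_def inj_eq)
    then show ?thesis
      unfolding b using ne that a0
      by (auto simp: wl wr simp flip: matrix_mul_assoc)
  qed
  have "det (minor_mat \<sigma> S ((mat 1 + w) ** a ** (mat 1 - w))) \<noteq> 0"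
    by (subst det_diagonal) (use a in \<open>auto simp: minor_mat_def entry\<close>)
  with S \<sigma>(1) square_zero_inverse[OF ww] show ?thesis
    unfolding a_def by blast
qed

text \<open>Lifting the arguments \<open>X\<close> to cyclic families makes the noncentral value a
  specialisation of one family \<open>M\<close>, all of whose specialisations are values of
  \<open>f\<close>. The cases are whether \<open>M\<close> has a nonzero off-diagonal entry or is
  diagonal throughout.\<close>

lemma ex_value_with_invertible_minor:
  fixes f :: "'f::field free_algebra" and X :: "nat \<Rightarrow> 'f ^ 'n::finite ^ 'n"
  assumes inf: "infinite (UNIV :: 'f set)" and "nc_eval (*) f X \<notin> mat_center"
  shows "\<exists>a \<in> nc_image (*) f. \<exists>\<pi> S. bij \<pi> \<and> S \<inter> \<pi> ` S = {} \<and> CARD('n) \<le> 3 * card S \<and>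
           det (minor_mat \<pi> S a :: 'f ^ 'n ^ 'n) \<noteq> 0"
proof -
  obtain \<sigma> :: "'n \<Rightarrow> 'n" where \<sigma>: "bij \<sigma>" "\<And>i j. \<exists>k. i = (\<sigma> ^^ k) j"
    using ex_cyclic_permutation by blast
  obtain B :: "'f set" where "finite B" "card B = CARD('n)"
    using infinite_arbitrarily_large[OF inf] by blast
  then obtain t\<^sub>0 :: "'n \<Rightarrow> 'f" where t\<^sub>0: "inj t\<^sub>0"
    using card_le_inj[of "UNIV :: 'n set" B] by auto
  obtain d where d: "\<And>v. cyclic_family \<sigma> (d v)" "\<And>v. map_mat (\<lambda>p. poly p 1) (d v t\<^sub>0) = X v"
  proof -
    have "\<forall>v. \<exists>d. cyclic_family \<sigma> d \<and> map_mat (\<lambda>p. poly p 1) (d t\<^sub>0) = X v"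
      using ex_cyclic_family_through[OF \<sigma> t\<^sub>0] by blast
    from choice[OF this] show ?thesis
      using that by blast
  qed
  define M where "M t = nc_eval smult f (\<lambda>v. d v t)" for t
  have M: "cyclic_family \<sigma> M"
    unfolding M_def using \<sigma>(1) d(1) by (rule cyclic_family_nc_eval)
  have hom: "ring_1_hom (\<lambda>p :: 'f poly. poly p y)" for y
    by unfold_locales simp_all
  have ev: "map_mat (\<lambda>p. poly p y) (M t) = nc_eval (*) f (\<lambda>v. map_mat (\<lambda>p. poly p y) (d v t))" for y t
    unfolding M_def by (rule ring_1_hom.map_mat_nc_eval[OF hom]) simp
  have val: "map_mat (\<lambda>p. poly p y) (M t) \<in> nc_image (*) f" for y t
    unfolding ev nc_image_def by blast
  show ?thesis
  proof (cases "\<exists>t i j. i \<noteq> j \<and> M t $ i $ j \<noteq> 0")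
    case True
    then obtain t\<^sub>1 i j where "i \<noteq> j" "M t\<^sub>1 $ i $ j \<noteq> 0" by blast
    from cyclic_family_off_diagonal[OF inf \<sigma> M this] show ?thesis
      using val by blast
  next
    case False
    then have diag: "\<And>t i j. i \<noteq> j \<Longrightarrow> M t $ i $ j = 0" by blast
    have "map_mat (\<lambda>p. poly p 1) (M t\<^sub>0) \<notin> mat_center"
      unfolding ev d(2) by (rule assms(2))
    from cyclic_family_diagonal[OF inf \<sigma> M diag this]
    obtain t y \<pi> S and g g' :: "'f ^ 'n ^ 'n" where *: "g ** g' = mat 1" "g' ** g = mat 1"
        "bij \<pi>" "S \<inter> \<pi> ` S = {}" "CARD('n) \<le> 3 * card S"
        "det (minor_mat \<pi> S (g ** map_mat (\<lambda>p. poly p y) (M t) ** g')) \<noteq> 0"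
      by blast
    have "g ** map_mat (\<lambda>p. poly p y) (M t) ** g' \<in> nc_image (*) f"
      by (rule conj_closedD[OF unital_algebra.conj_closed_nc_image[OF unital_algebra_field] val *(1,2)])
    then show ?thesis
      using *(3-) by blast
  qed
qed

text \<open>The embedding of scalars into \<open>B\<close> carries \<open>a\<close> to a value of
  \<open>f\<close> and preserves the equations by which \<open>t\<close> inverts the minor, so a
  good value over the field is good over \<open>B\<close>.\<close>

lemma (in unital_algebra) commutator_sum_of_differences_nc_image:
  fixes f :: "'f free_algebra" and X :: "nat \<Rightarrow> 'f ^ 'n::finite ^ 'n" and x y :: "'b ^ 'n ^ 'n"
  assumes "infinite (UNIV :: 'f set)" "CHAR('f) \<noteq> 2" "nc_eval (*) f X \<notin> mat_center"
  shows "x ** y - y ** x \<in> sums_of 108 (differences (nc_image smul f))"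
proof -
  obtain a :: "'f ^ 'n ^ 'n" and \<pi> S where a: "a \<in> nc_image (*) f"
    and S: "bij \<pi>" "S \<inter> \<pi> ` S = {}" "CARD('n) \<le> 3 * card S" "det (minor_mat \<pi> S a) \<noteq> 0"
    using ex_value_with_invertible_minor assms by blast
  obtain t where t: "t \<in> block S (\<pi> ` S)" "t ** a ** diag_proj S = diag_proj S"
      "diag_proj (\<pi> ` S) ** a ** t = diag_proj (\<pi> ` S)"
    using minor_mat_inverse[OF S(1,4)] by blast
  interpret h: ring_1_hom "\<lambda>c. smul c 1"
    by (rule ring_1_hom_scalar)
  let ?h = "map_mat (\<lambda>c. smul c 1) :: 'f ^ 'n ^ 'n \<Rightarrow> 'b ^ 'n ^ 'n"
  obtain Y where "a = nc_eval (*) f Y"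
    using a by (auto simp: nc_image_def)
  then have "?h a = nc_eval smul f (\<lambda>v. ?h (Y v))"
    by (simp add: h.map_mat_nc_eval[of "(*)" smul])
  then have 1: "?h a \<in> nc_image smul f"
    by (auto simp: nc_image_def)
  have two: "(2 :: 'f) \<noteq> 0"
  proof
    assume "(2 :: 'f) = 0"
    then have "of_nat 2 = (0 :: 'f)" by simp
    then have "CHAR('f) dvd 2"
      by (simp only: of_nat_eq_0_iff_char_dvd)
    then have "CHAR('f) = 1"
      using assms(2) two_is_prime_nat unfolding prime_nat_iff by blast
    then show False by simp
  qed
  have "smul (1 / 2) 1 + smul (1 / 2) 1 = (1 :: 'b)"
    using two by (simp flip: scale_left_distrib)
  moreover have "?h t \<in> block S (\<pi> ` S)" 
    using t(1) by (auto simp: block_def)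
  moreover have "?h t ** ?h a ** diag_proj S = diag_proj S"
      "diag_proj (\<pi> ` S) ** ?h a ** ?h t = diag_proj (\<pi> ` S)"
    using t(2,3) by (metis h.map_mat_mult h.map_mat_diag_proj)+
  moreover have "card S = card (\<pi> ` S)"
    by (rule card_image[OF inj_on_subset[OF bij_is_inj[OF S(1)] subset_UNIV], symmetric])
  ultimately show ?thesis
    using commutator_sum_of_differences[OF conj_closed_nc_image 1] S(2,3) by blast
qed

theorem theorem3p12:
  fixes f :: "'f::field free_algebra"
    and smul :: "'f \<Rightarrow> 'b::ring_1 \<Rightarrow> 'b"
    and m k :: nat
  assumes "infinite (UNIV :: 'f set)"
    and "CHAR('f) \<noteq> 2"
    and "CARD('n::finite) \<ge> 2"
    and "nc_vars f \<subseteq> {1..m}"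
    and "\<not> nc_identity TYPE('n) ((*) :: 'f \<Rightarrow> 'f \<Rightarrow> 'f) f"
    and "\<not> nc_central_polynomial TYPE('n) ((*) :: 'f \<Rightarrow> 'f \<Rightarrow> 'f) f"
    and "k \<ge> 1"
    and "unital_algebra smul"
    and "\<forall>x :: 'b ^ 'n ^ 'n. \<exists>c \<in> sums_of k mat_commutators. \<exists>z \<in> mat_center. x = c + z"
  shows "\<forall>x \<in> (mat_commutators :: ('b ^ 'n ^ 'n) set).
           x \<in> sums_of (1936 * k ^ 2 + 22 * k) (differences (nc_image smul f))"
proof
  fix x :: "'b ^ 'n ^ 'n"
  assume "x \<in> mat_commutators"
  then obtain y z where x: "x = y ** z - z ** y"
    by (auto simp: mat_commutators_def)
  \<comment> \<open>Not being an identity, \<open>f\<close> would be a central polynomial if all its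
    values were central.\<close>
  obtain X :: "nat \<Rightarrow> 'f ^ 'n ^ 'n" where "nc_eval (*) f X \<notin> mat_center"
    using assms(5,6) by (auto simp: nc_central_polynomial_def nc_image_def)
  then have "x \<in> sums_of 108 (differences (nc_image smul f))"
    unfolding x using assms(1,2)
    by (intro unital_algebra.commutator_sum_of_differences_nc_image[OF assms(8)])
  moreover have "0 \<in> differences (nc_image smul f :: ('b ^ 'n ^ 'n) set)"
    unfolding differences_def nc_image_def by force
  \<comment> \<open>For \<open>k \<ge> 1\<close> the bound is at least \<open>1936 + 22\<close>;
    zeros pad the shorter sum.\<close>
  moreover have "108 \<le> 1936 * k ^ 2 + 22 * k"
    using one_le_power[OF \<open>k \<ge> 1\<close>, of 2] by linarith
  ultimately show "x \<in> sums_of (1936 * k ^ 2 + 22 * k) (differences (nc_image smul f))"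
    using sums_of_mono by blast
qed

end
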